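(* Let $\widehat E=E+\varepsilon E_0$ and $\widehat F=F+\varepsilon F_0$ be dual matrices in $\mathbb{D}^{m\times n}$ whose dual Moore-Penrose generalized inverses (DMPGIs) exist. Then $\widehat E\overset{\rm D}{\leq}\widehat F$ (Dual-minus order) if and only if $$\begin{pmatrix} E_0 & E \\ E & O \end{pmatrix}\leq\begin{pmatrix} F_0 & F \\ F & O \end{pmatrix},$$ where $\leq$ is the minus partial order on real $2m\times 2n$ matrices.
   Context: $\varepsilon$ is the dual unit: $\varepsilon\neq 0$, $\varepsilon^2=0$, commuting with reals. $\mathbb{D}^{m\times n}$ is the set of $m\times n$ dual matrices $\widehat E=E+\varepsilon E_0$ with $E,E_0\in\mathbb{R}^{m\times n}$, with the obvious addition, multiplication and transpose $\widehat E^{T}=E^T+\varepsilon E_0^T$. The DMPGI of $\widehat E\in\mathbb{D}^{m\times n}$ is the unique $\widehat X\in\mathbb{D}^{n\times m}$, if it exists, with $\widehat E\widehat X\widehat E=\widehat E$, $\widehat X\widehat E\widehat X=\widehat X$, $(\widehat E\widehat X)^T=\widehat E\widehat X$, $(\widehat X\widehat E)^T=\widehat X\widehat E$. Minus partial order on real matrices of the same size: $A\leq B$ means $\mathrm{rk}(B-A)=\mathrm{rk}(B)-\mathrm{rk}(A)$. Dual-minus order: for $\widehat E,\widehat F\in\mathbb{D}^{m\times n}$ whose DMPGIs exist, $\widehat E\overset{\rm D}{\leq}\widehat F$ means that $E\leq F$ and the DMPGI of $\widehat F-\widehat E$ exists. *)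

theory Defs
  imports "HOL-Analysis.Analysis"
begin

text \<open>
  The dual number \<open>Dual a b\<close> stands for \<open>a + \<epsilon> b\<close>. Dual numbers form a commutative ring, so the
  library operations \<open>+\<close>, \<open>-\<close>, \<open>**\<close> and \<open>transpose\<close> apply to dual matrices, which have type
  \<open>dual_num ^ 'n ^ 'm\<close>.
\<close>

datatype dual_num = Dual (std_part: real) (inf_part: real)

instantiation dual_num :: comm_ring_1
begin

definition zero_dual_num :: dual_num
  where "0 = Dual 0 0"

definition one_dual_num :: dual_num
  where "1 = Dual 1 0"

definition plus_dual_num :: "dual_num \<Rightarrow> dual_num \<Rightarrow> dual_num"
  where "x + y = Dual (std_part x + std_part y) (inf_part x + inf_part y)"

definition uminus_dual_num :: "dual_num \<Rightarrow> dual_num"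
  where "- x = Dual (- std_part x) (- inf_part x)"

definition minus_dual_num :: "dual_num \<Rightarrow> dual_num \<Rightarrow> dual_num"
  where "x - y = Dual (std_part x - std_part y) (inf_part x - inf_part y)"

definition times_dual_num :: "dual_num \<Rightarrow> dual_num \<Rightarrow> dual_num"
  where "x * y = Dual (std_part x * std_part y)
                      (std_part x * inf_part y + inf_part x * std_part y)"

instance
  by standard
    (simp_all add: zero_dual_num_def one_dual_num_def plus_dual_num_def uminus_dual_num_def
      minus_dual_num_def times_dual_num_def algebra_simps)

end

definition dual_unit :: dual_num
  where "dual_unit = Dual 0 1"

lemma dual_unit_neq_0: "dual_unit \<noteq> 0"
  by (simp add: dual_unit_def zero_dual_num_def)

lemma dual_unit_squared: "dual_unit * dual_unit = 0"
  by (simp add: dual_unit_def zero_dual_num_def times_dual_num_def)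

lemma Dual_eq: "Dual a b = Dual a 0 + dual_unit * Dual b 0"
  by (simp add: dual_unit_def plus_dual_num_def times_dual_num_def)

text \<open>The dual matrix \<open>E + \<epsilon> E0\<close>:\<close>

definition dual_mat :: "real ^ 'n ^ 'm \<Rightarrow> real ^ 'n ^ 'm \<Rightarrow> dual_num ^ 'n ^ 'm"
  where "dual_mat E E0 = (\<chi> i j. Dual (E $ i $ j) (E0 $ i $ j))"

definition std_mat :: "dual_num ^ 'n ^ 'm \<Rightarrow> real ^ 'n ^ 'm"
  where "std_mat A = (\<chi> i j. std_part (A $ i $ j))"

definition inf_mat :: "dual_num ^ 'n ^ 'm \<Rightarrow> real ^ 'n ^ 'm"
  where "inf_mat A = (\<chi> i j. inf_part (A $ i $ j))"

lemma std_mat_dual_mat [simp]: "std_mat (dual_mat E E0) = E"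
  by (simp add: std_mat_def dual_mat_def vec_eq_iff)

lemma inf_mat_dual_mat [simp]: "inf_mat (dual_mat E E0) = E0"
  by (simp add: inf_mat_def dual_mat_def vec_eq_iff)

lemma dual_mat_std_inf [simp]: "dual_mat (std_mat A) (inf_mat A) = A"
  by (simp add: std_mat_def inf_mat_def dual_mat_def vec_eq_iff)

definition is_DMPGI :: "dual_num ^ 'n ^ 'm \<Rightarrow> dual_num ^ 'm ^ 'n \<Rightarrow> bool"
  where "is_DMPGI A X \<longleftrightarrow>
    A ** X ** A = A \<and> X ** A ** X = X \<and>
    transpose (A ** X) = A ** X \<and> transpose (X ** A) = X ** A"

lemma is_DMPGI_unique:
  fixes A :: "dual_num ^ 'n ^ 'm"
  assumes "is_DMPGI A X" and "is_DMPGI A Y"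
  shows "X = Y"
proof -
  have X: "A ** X ** A = A" "X ** A ** X = X"
      "transpose (A ** X) = A ** X" "transpose (X ** A) = X ** A"
    and Y: "A ** Y ** A = A" "Y ** A ** Y = Y"
      "transpose (A ** Y) = A ** Y" "transpose (Y ** A) = Y ** A"
    using assms by (auto simp: is_DMPGI_def)
  have "A ** X = transpose ((A ** Y) ** (A ** X))"
    using X Y by (simp add: matrix_mul_assoc)
  also have "\<dots> = (A ** X) ** (A ** Y)"
    using X Y by (metis matrix_transpose_mul)
  also have "\<dots> = A ** Y"
    using X by (simp add: matrix_mul_assoc)
  finally have AX: "A ** X = A ** Y" .
  have "X ** A = transpose ((X ** A) ** (Y ** A))"
    using X Y by (metis matrix_mul_assoc)
  also have "\<dots> = (Y ** A) ** (X ** A)"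
    using X Y by (metis matrix_transpose_mul)
  also have "\<dots> = Y ** A"
    using X by (metis matrix_mul_assoc)
  finally have XA: "X ** A = Y ** A" .
  show ?thesis
    using X(2) Y(2) AX XA by (metis matrix_mul_assoc)
qed

definition has_DMPGI :: "dual_num ^ 'n ^ 'm \<Rightarrow> bool"
  where "has_DMPGI A \<longleftrightarrow> (\<exists>X. is_DMPGI A X)"

text \<open>The ranks are cast to \<open>int\<close> because subtraction on \<open>nat\<close> truncates.\<close>

definition minus_le :: "real ^ 'n ^ 'm \<Rightarrow> real ^ 'n ^ 'm \<Rightarrow> bool"
  where "minus_le A B \<longleftrightarrow> int (rank (B - A)) = int (rank B) - int (rank A)"

text \<open>Only meaningful if both arguments have a DMPGI.\<close>

definition dual_minus_le :: "dual_num ^ 'n ^ 'm \<Rightarrow> dual_num ^ 'n ^ 'm \<Rightarrow> bool"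
  where "dual_minus_le A B \<longleftrightarrow> minus_le (std_mat A) (std_mat B) \<and> has_DMPGI (B - A)"

text \<open>
  The block matrix with upper blocks \<open>A\<close>, \<open>B\<close> and lower blocks \<open>C\<close>, \<open>D\<close>; an index \<open>Inl i\<close> refers
  to the first block of rows (columns), \<open>Inr i\<close> to the second.
\<close>

definition block_mat ::
    "real ^ 'n ^ 'm \<Rightarrow> real ^ 'q ^ 'm \<Rightarrow> real ^ 'n ^ 'p \<Rightarrow> real ^ 'q ^ 'p \<Rightarrow> real ^ ('n + 'q) ^ ('m + 'p)"
  where "block_mat A B C D =
    (\<chi> i j. case i of
        Inl i' \<Rightarrow> (case j of Inl j' \<Rightarrow> A $ i' $ j' | Inr j' \<Rightarrow> B $ i' $ j')
      | Inr i' \<Rightarrow> (case j of Inl j' \<Rightarrow> C $ i' $ j' | Inr j' \<Rightarrow> D $ i' $ j'))"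

end

theory Submission imports Defs begin

text \<open>
  Projecting the range of the block matrix with blocks \<open>A0\<close>, \<open>A\<close>, \<open>A\<close>, \<open>0\<close> onto the second component
  gives \<open>rank A + dim (A0 (ker A) + im A)\<close> for its rank. So this rank is at least \<open>2 * rank A\<close>, with
  equality iff \<open>A0\<close> maps \<open>ker A\<close> into \<open>im A\<close>, which is exactly the condition for \<open>A + \<epsilon> A0\<close> to have a
  DMPGI. Hence the blocks of \<open>E\<close> and \<open>F\<close> have ranks \<open>2 * rank E\<close> and \<open>2 * rank F\<close>, and the block minus
  order says that the block of \<open>F - E\<close> has rank \<open>2 * (rank F - rank E)\<close>. This is a lower bound for its
  rank in two steps, through \<open>2 * rank (F - E)\<close>; equality in both steps is the dual-minus order.
\<close>

section \<open>Rank-nullity and ranks of block matrices\<close>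

lemma dim_eq_dim_image_plus_dim_kernel:
  fixes f :: "'a::euclidean_space \<Rightarrow> 'b::euclidean_space"
  assumes f: "linear f" and S: "subspace S"
  shows "dim S = dim (f ` S) + dim {x \<in> S. f x = 0}"
proof -
  define K where "K = {x \<in> S. f x = 0}"
  define C where "C = {y \<in> S. \<forall>x \<in> K. orthogonal x y}"
  have K: "subspace K"
    using S f by (auto simp: K_def subspace_def linear_0 linear_add linear_scale)
  have C: "subspace C"
    using S unfolding C_def subspace_def
    by (auto simp: orthogonal_clauses)
  have "inj_on f C"
  proof (rule inj_onI)
    fix x y assume "x \<in> C" "y \<in> C" and eq: "f x = f y"
    then have "x - y \<in> C" using C by (simp add: subspace_diff)
    moreover have "f (x - y) = 0" using eq f by (simp add: linear_diff)
    ultimately have "orthogonal (x - y) (x - y)"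
      by (auto simp: C_def K_def)
    then show "x = y" by (simp add: orthogonal_self)
  qed
  then have 1: "dim (f ` C) = dim C"
    using dim_image_eq[OF f] C by (metis span_eq_iff)
  have 2: "f ` C = f ` S"
  proof
    show "f ` S \<subseteq> f ` C"
    proof
      fix z assume "z \<in> f ` S"
      then obtain x where x: "x \<in> S" "z = f x" by auto
      obtain y w where y: "y \<in> span K" and w: "\<And>v. v \<in> span K \<Longrightarrow> orthogonal w v"
        and xyw: "x = y + w"
        using orthogonal_subspace_decomp_exists by metis
      have yK: "y \<in> K" using y K by (metis span_eq_iff)
      then have "y \<in> S" "f y = 0" by (auto simp: K_def)
      then have "w \<in> S" using S x xyw by (metis subspace_diff add_diff_cancel_left')
      then have "w \<in> C" using w by (auto simp: C_def orthogonal_commute span_base)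
      moreover have "f x = f w" using xyw \<open>f y = 0\<close> f by (simp add: linear_add)
      ultimately show "z \<in> f ` C" using x by auto
    qed
  qed (auto simp: C_def)
  have "dim C + dim K = dim S"
    unfolding C_def by (rule dim_subspace_orthogonal_to_vectors) (use K S K_def in auto)
  with 1 2 show ?thesis by (simp add: K_def)
qed

lemma block_mat_mult_vec:
  "block_mat A B C D *v w = (\<chi> i. case i of
     Inl i' \<Rightarrow> (A *v (\<chi> k. w $ Inl k) + B *v (\<chi> k. w $ Inr k)) $ i'
   | Inr i' \<Rightarrow> (C *v (\<chi> k. w $ Inl k) + D *v (\<chi> k. w $ Inr k)) $ i')"
  by (simp add: block_mat_def matrix_vector_mult_def vec_eq_iff sum.Plus flip: UNIV_Plus_UNIV split: sum.split)

text \<open>Rank-nullity for the projection \<open>p\<close> to the lower block, restricted to the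
  range of the block matrix: the image is the range of \<open>C\<close>, and the kernel is the
  displayed set, embedded by \<open>e\<close> with zeros below.\<close>

lemma rank_block_mat_0:
  fixes A :: "real ^ 'n ^ 'm" and B :: "real ^ 'q ^ 'm" and C :: "real ^ 'n ^ 'p"
  shows "rank (block_mat A B C 0) = rank C + dim {A *v x + B *v y | x y. C *v x = 0}"
proof -
  let ?M = "block_mat A B C 0"
  define W where "W = {A *v x + B *v y | x y. C *v x = 0}"
  define p :: "real ^ ('m + 'p) \<Rightarrow> real ^ 'p" where "p w = (\<chi> i. w $ Inr i)" for w
  define e :: "real ^ 'm \<Rightarrow> real ^ ('m + 'p)"
    where "e u = (\<chi> i. case i of Inl i' \<Rightarrow> u $ i' | Inr i' \<Rightarrow> 0)" for u
  define pair :: "real ^ 'n \<Rightarrow> real ^ 'q \<Rightarrow> real ^ ('n + 'q)"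
    where "pair x y = (\<chi> i. case i of Inl i' \<Rightarrow> x $ i' | Inr i' \<Rightarrow> y $ i')" for x y
  have Mp: "?M *v pair x y = (\<chi> i. case i of Inl i' \<Rightarrow> (A *v x + B *v y) $ i' | Inr i' \<Rightarrow> (C *v x) $ i')" for x y
    by (simp add: block_mat_mult_vec pair_def vec_eq_iff split: sum.split)
  have pair: "\<exists>x y. w = pair x y" for w
    by (rule exI[of _ "\<chi> k. w $ Inl k"], rule exI[of _ "\<chi> k. w $ Inr k"])
      (simp add: pair_def vec_eq_iff split: sum.split)
  have p: "linear p" by (rule linearI) (simp_all add: p_def vec_eq_iff)
  have e: "linear e" by (rule linearI) (simp_all add: e_def vec_eq_iff split: sum.split)
  have "inj e" by (rule injI) (auto simp: e_def vec_eq_iff split: sum.split_asm)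
  then have dim_e: "dim (e ` W) = dim W"
    using e by (intro dim_image_eq) (auto intro: inj_on_subset)
  have pM: "p (?M *v pair x y) = C *v x" for x y
    by (simp add: Mp p_def vec_eq_iff)
  have rng: "range ((*v) ?M) = {?M *v pair x y | x y. True}"
    using pair by (auto, metis)
  have 1: "p ` range ((*v) ?M) = range ((*v) C)"
    unfolding rng by (auto simp: pM) (metis (mono_tags, lifting) image_eqI mem_Collect_eq pM)
  have eM: "?M *v pair x y = e (A *v x + B *v y)" if "C *v x = 0" for x y
    using that by (simp add: Mp e_def vec_eq_iff split: sum.split)
  have 2: "{w \<in> range ((*v) ?M). p w = 0} = e ` W"
  proof (intro set_eqI iffI)
    fix w assume "w \<in> {w \<in> range ((*v) ?M). p w = 0}"
    then obtain x y where w: "w = ?M *v pair x y" and "p w = 0" unfolding rng by auto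
    then have "C *v x = 0" by (simp add: pM)
    then show "w \<in> e ` W" using eM w by (auto simp: W_def)
  next
    fix w assume "w \<in> e ` W"
    then obtain x y where "w = e (A *v x + B *v y)" and "C *v x = 0" by (auto simp: W_def)
    then show "w \<in> {w \<in> range ((*v) ?M). p w = 0}" using eM pM by (metis (mono_tags, lifting) mem_Collect_eq rangeI)
  qed
  have "subspace (range ((*v) ?M))"
    by (intro linear_subspace_image) auto
  from dim_eq_dim_image_plus_dim_kernel[OF p this] show ?thesis
    unfolding 1 2 dim_e by (simp add: rank_dim_range W_def)
qed

lemma rank_add_le: "rank (A + B) \<le> rank A + rank (B :: real ^ 'n ^ 'm)"
proof -
  have "subspace (range ((*v) A))" "subspace (range ((*v) B))"
    by (auto intro: linear_subspace_image)
  note d = dim_sums_Int[OF this]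
  have "rank (A + B) \<le> dim {x + y |x y. x \<in> range ((*v) A) \<and> y \<in> range ((*v) B)}"
    unfolding rank_dim_range by (rule dim_subset) (auto simp: matrix_vector_mult_add_rdistrib)
  with d show ?thesis by (simp add: rank_dim_range)
qed

lemma rank_block_mat_dual:
  fixes A A0 :: "real ^ 'n ^ 'm"
  shows "2 * rank A \<le> rank (block_mat A0 A A 0)"
    and "rank (block_mat A0 A A 0) = 2 * rank A \<longleftrightarrow>
      (\<forall>x. A *v x = 0 \<longrightarrow> A0 *v x \<in> range ((*v) A))"
proof -
  define W where "W = {A0 *v x + A *v y | x y. A *v x = 0}"
  have r: "rank (block_mat A0 A A 0) = rank A + dim W"
    unfolding W_def by (rule rank_block_mat_0)
  have sub: "subspace (range ((*v) A))"
    by (intro linear_subspace_image) auto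
  have "subspace W"
    unfolding subspace_def
  proof (intro conjI ballI allI)
    show "0 \<in> W" unfolding W_def by (intro CollectI exI[of _ 0]) simp
  next
    fix u v assume "u \<in> W" "v \<in> W"
    then obtain x y x' y' where "u = A0 *v x + A *v y" "A *v x = 0" "v = A0 *v x' + A *v y'" "A *v x' = 0"
      unfolding W_def by blast
    then show "u + v \<in> W" unfolding W_def
      by (intro CollectI exI[of _ "x + x'"] exI[of _ "y + y'"]) (simp add: algebra_simps)
  next
    fix c u assume "u \<in> W"
    then obtain x y where "u = A0 *v x + A *v y" "A *v x = 0"
      unfolding W_def by blast
    then show "c *\<^sub>R u \<in> W" unfolding W_def
      by (intro CollectI exI[of _ "c *\<^sub>R x"] exI[of _ "c *\<^sub>R y"]) (simp add: algebra_simps)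
  qed
  have incl: "range ((*v) A) \<subseteq> W"
    unfolding W_def by (force intro: exI[of _ 0])
  then have le: "rank A \<le> dim W"
    by (simp add: rank_dim_range dim_subset)
  then show "2 * rank A \<le> rank (block_mat A0 A A 0)" using r by simp
  \<comment> \<open>Nested subspaces of equal dimension coincide.\<close>
  have "rank (block_mat A0 A A 0) = 2 * rank A \<longleftrightarrow> W = range ((*v) A)"
    using r le incl subspace_dim_equal[OF sub \<open>subspace W\<close> incl] by (auto simp: rank_dim_range)
  also have "\<dots> \<longleftrightarrow> (\<forall>x. A *v x = 0 \<longrightarrow> A0 *v x \<in> range ((*v) A))"
  proof
    assume W: "W = range ((*v) A)"
    show "\<forall>x. A *v x = 0 \<longrightarrow> A0 *v x \<in> range ((*v) A)"
      unfolding W[symmetric] W_def by (force intro: exI[of _ 0])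
  next
    assume "\<forall>x. A *v x = 0 \<longrightarrow> A0 *v x \<in> range ((*v) A)"
    then have "W \<subseteq> range ((*v) A)"
      using sub unfolding W_def by (auto intro!: subspace_add)
    with incl show "W = range ((*v) A)" by blast
  qed
  finally show "rank (block_mat A0 A A 0) = 2 * rank A \<longleftrightarrow>
      (\<forall>x. A *v x = 0 \<longrightarrow> A0 *v x \<in> range ((*v) A))" .
qed

section \<open>Arithmetic of dual and block matrices\<close>

lemma matrix_add_rdistrib:
  "((A :: 'a::semiring_1 ^ 'n ^ 'm) + B) ** C = A ** C + B ** C"
  by (simp add: matrix_matrix_mult_def vec_eq_iff distrib_right sum.distrib)

lemma matrix_diff_ldistrib:
  "(C :: 'a::ring_1 ^ 'n ^ 'm) ** (A - B) = C ** A - C ** B"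
  by (simp add: matrix_matrix_mult_def vec_eq_iff right_diff_distrib sum_subtractf)

lemma matrix_diff_rdistrib:
  "((A :: 'a::ring_1 ^ 'n ^ 'm) - B) ** C = A ** C - B ** C"
  by (simp add: matrix_matrix_mult_def vec_eq_iff left_diff_distrib sum_subtractf)

lemma transpose_add: "transpose (A + B) = transpose A + transpose B"
  by (simp add: transpose_def vec_eq_iff)

lemma transpose_diff: "transpose (A - B) = transpose A - transpose B"
  by (simp add: transpose_def vec_eq_iff)

lemma sum_Dual: "(\<Sum>k\<in>S. Dual (f k) (g k)) = Dual (sum f S) (sum g S)"
  by (induction S rule: infinite_finite_induct) (auto simp: zero_dual_num_def plus_dual_num_def)

lemma dual_mat_mult: "dual_mat A A0 ** dual_mat B B0 = dual_mat (A ** B) (A ** B0 + A0 ** B)"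
  by (simp add: dual_mat_def matrix_matrix_mult_def vec_eq_iff times_dual_num_def sum_Dual sum.distrib)

lemma dual_mat_transpose: "transpose (dual_mat A A0) = dual_mat (transpose A) (transpose A0)"
  by (simp add: dual_mat_def transpose_def vec_eq_iff)

lemma dual_mat_diff: "dual_mat A A0 - dual_mat B B0 = dual_mat (A - B) (A0 - B0)"
  by (simp add: dual_mat_def vec_eq_iff minus_dual_num_def)

lemma dual_mat_eq_iff: "dual_mat A A0 = dual_mat B B0 \<longleftrightarrow> A = B \<and> A0 = B0"
  by (metis std_mat_dual_mat inf_mat_dual_mat)

lemma block_mat_diff:
  "block_mat A B C D - block_mat A' B' C' D' = block_mat (A - A') (B - B') (C - C') (D - D')"
  by (simp add: block_mat_def vec_eq_iff split: sum.split)

section \<open>The real Moore-Penrose inverse\<close>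

text \<open>Least squares: split \<open>b\<close> into a part \<open>A *v x\<close> in the range of
  \<open>A\<close> and a part orthogonal to it. The transpose of \<open>A\<close> annihilates the
  latter, so \<open>x\<close> solves the normal equation for \<open>b\<close>. The columns of
  \<open>G\<close> are such solutions for the basis vectors.\<close>

lemma normal_equation_solvable:
  fixes A :: "real ^ 'n ^ 'm"
  shows "\<exists>G. transpose A ** A ** G = transpose A"
proof -
  have "\<exists>x. transpose A *v (A *v x) = transpose A *v b" for b
  proof -
    obtain y z where y: "y \<in> span (range ((*v) A))"
      and z: "\<And>v. v \<in> span (range ((*v) A)) \<Longrightarrow> orthogonal z v" and b: "b = y + z"
      using orthogonal_subspace_decomp_exists by metis
    have "subspace (range ((*v) A))"
      by (intro linear_subspace_image) auto
    with y obtain x where x: "y = A *v x" by (metis span_eq_iff imageE)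
    have "(transpose A *v z) \<bullet> u = 0" for u
      using z[of "A *v u"] by (simp add: dot_lmul_matrix span_base orthogonal_def)
    then have "transpose A *v z = 0" by (metis inner_eq_zero_iff)
    then show ?thesis using x b by (intro exI[of _ x]) (simp only: matrix_vector_right_distrib add_0_right)
  qed
  then obtain g where g: "\<And>b. transpose A *v (A *v g b) = transpose A *v b" by metis
  define G where "G = transpose (\<chi> j. g (axis j 1))"
  have G: "G *v axis j 1 = g (axis j 1)" for j
    by (simp add: G_def matrix_vector_mult_basis row_def vec_eq_iff)
  have "(transpose A ** A ** G) *v axis j 1 = transpose A *v axis j 1" for j
    using g[of "axis j 1"] G[of j] by (simp only: matrix_vector_mul_assoc[symmetric])
  then have "column j (transpose A ** A ** G) = column j (transpose A)" for j
    by (simp only: matrix_vector_mult_basis)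
  then have "transpose A ** A ** G = transpose A"
    by (simp add: column_def vec_eq_iff)
  then show ?thesis ..
qed

lemma real_MP_inverse_exists:
  fixes A :: "real ^ 'n ^ 'm"
  obtains P where "A ** P ** A = A" "P ** A ** P = P"
    "transpose (A ** P) = A ** P" "transpose (P ** A) = P ** A"
proof -
  \<comment> \<open>\<open>G\<close> is an inner inverse with \<open>A ** G\<close> symmetric, \<open>H\<close> one with \<open>H ** A\<close> symmetric; then \<open>H ** A ** G\<close> works.\<close>
  obtain G where G: "transpose A ** A ** G = transpose A"
    using normal_equation_solvable by blast
  obtain H' where H': "A ** transpose A ** H' = A"
    using normal_equation_solvable[of "transpose A"] by (metis transpose_transpose)
  define H where "H = transpose H'"
  have H: "H ** A ** transpose A = transpose A"
    using arg_cong[OF H', of transpose]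
    by (simp add: matrix_transpose_mul H_def matrix_mul_assoc)
  have G_sym: "transpose (A ** G) = A ** G"
  proof -
    \<comment> \<open>Multiplying \<open>G\<close> from the left by \<open>transpose G\<close>
      writes the transpose of \<open>A ** G\<close> as a product \<open>transpose M ** M\<close>,
      which is symmetric.\<close>
    have "transpose (A ** G) = transpose G ** (transpose A ** A ** G)"
      by (simp add: G matrix_transpose_mul)
    also have "\<dots> = transpose (A ** G) ** (A ** G)"
      by (simp add: matrix_transpose_mul matrix_mul_assoc)
    finally show ?thesis by (metis matrix_transpose_mul transpose_transpose)
  qed
  have H_sym: "transpose (H ** A) = H ** A"
  proof -
    have "transpose (H ** A) = (H ** A ** transpose A) ** transpose H"
      by (simp add: H matrix_transpose_mul)
    also have "\<dots> = (H ** A) ** transpose (H ** A)"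
      by (simp add: matrix_transpose_mul matrix_mul_assoc)
    finally show ?thesis by (metis matrix_transpose_mul transpose_transpose)
  qed
  have AGA: "A ** G ** A = A"
    using arg_cong[OF G, of transpose] G_sym
    by (metis matrix_transpose_mul transpose_transpose matrix_mul_assoc)
  have AHA: "A ** H ** A = A"
    using arg_cong[OF H, of transpose] H_sym
    by (metis matrix_transpose_mul transpose_transpose matrix_mul_assoc)
  let ?P = "H ** A ** G"
  have AP: "A ** ?P = A ** G" and PA: "?P ** A = H ** A"
    using AGA AHA by (metis matrix_mul_assoc)+
  show thesis
  proof (rule that[of ?P])
    show "?P ** A ** ?P = ?P" unfolding PA using AHA by (metis matrix_mul_assoc)
  qed (simp_all add: AP PA AGA G_sym H_sym)
qed

section \<open>Existence criterion for the DMPGI\<close>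

text \<open>On the kernel of \<open>A\<close>, the infinitesimal part of the first Penrose equation
  leaves only \<open>A0 *v x = A *v (X *v (A0 *v x))\<close>. Conversely, the condition says
  \<open>(I - A P) A0 (I - P A) = 0\<close>, and an explicit infinitesimal part \<open>X0\<close>
  then completes \<open>P\<close>.\<close>

lemma has_DMPGI_dual_mat_iff:
  fixes A A0 :: "real ^ 'n ^ 'm"
  shows "has_DMPGI (dual_mat A A0) \<longleftrightarrow> (\<forall>x. A *v x = 0 \<longrightarrow> A0 *v x \<in> range ((*v) A))"
    (is "_ \<longleftrightarrow> ?R")
proof
  assume "has_DMPGI (dual_mat A A0)"
  then obtain X X0 where X: "dual_mat A A0 ** dual_mat X X0 ** dual_mat A A0 = dual_mat A A0"
    unfolding has_DMPGI_def is_DMPGI_def by (metis dual_mat_std_inf)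
  then have A0: "A0 = A ** X ** A0 + (A ** X0 + A0 ** X) ** A"
    by (simp add: dual_mat_mult dual_mat_eq_iff)
  show ?R
  proof (intro allI impI)
    fix x assume x: "A *v x = 0"
    have "A0 *v x = A *v (X *v (A0 *v x)) + (A ** X0 + A0 ** X) *v (A *v x)"
      by (subst A0) (simp add: matrix_vector_mult_add_rdistrib matrix_vector_mul_assoc matrix_mul_assoc)
    with x show "A0 *v x \<in> range ((*v) A)" by simp
  qed
next
  assume R: ?R
  obtain P where P: "A ** P ** A = A" "P ** A ** P = P"
    "transpose (A ** P) = A ** P" "transpose (P ** A) = P ** A"
    by (rule real_MP_inverse_exists)
  \<comment> \<open>\<open>I - P A\<close> maps into the kernel of \<open>A\<close>, so
    \<open>A0 (I - P A) x\<close> lies in the range of \<open>A\<close>, where \<open>A P\<close>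
    acts as the identity.\<close>
  have "(A0 - A0 ** P ** A) *v x = (A ** P ** (A0 - A0 ** P ** A)) *v x" for x
  proof -
    have "A *v (x - P ** A *v x) = A *v x - (A ** P ** A) *v x"
      by (simp add: matrix_vector_mult_diff_distrib matrix_vector_mul_assoc matrix_mul_assoc)
    then have "A *v (x - P ** A *v x) = 0" by (simp add: P)
    with R obtain y where "A0 *v (x - P ** A *v x) = A *v y" by blast
    then have y: "(A0 - A0 ** P ** A) *v x = A *v y"
      by (simp add: matrix_vector_mult_diff_distrib matrix_vector_mult_diff_rdistrib
        matrix_vector_mul_assoc matrix_mul_assoc)
    have "(A ** P ** (A0 - A0 ** P ** A)) *v x = (A ** P ** A) *v y"
      using y by (simp only: matrix_vector_mul_assoc[symmetric])
    with y show ?thesis by (simp add: P)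
  qed
  then have "A0 - A0 ** P ** A = A ** P ** (A0 - A0 ** P ** A)"
    by (simp add: matrix_eq)
  \<comment> \<open>The left side is what the infinitesimal part of the first Penrose equation
    reduces to for the \<open>X0\<close> below.\<close>
  then have A0: "A0 ** P ** A + A ** P ** A0 - A ** P ** A0 ** P ** A = A0"
    by (simp add: matrix_diff_ldistrib matrix_mul_assoc algebra_simps)
  let ?T = "transpose A0" and ?Q = "transpose P"
  have PQ: "?Q ** transpose A = A ** P" "transpose A ** ?Q = P ** A"
    using P by (simp_all add: matrix_transpose_mul)
  have APQ: "A ** P ** ?Q = ?Q" and QPA: "?Q ** P ** A = ?Q"
    using P by (metis matrix_transpose_mul matrix_mul_assoc)+
  note r = P(1,2) PQ APQ QPA
  \<comment> \<open>Products are normalized to the right, so each cancellation also needs a version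
    with a trailing factor to apply inside a longer product.\<close>
  have r': "A ** (P ** (A ** Y)) = A ** Y" "P ** (A ** (P ** Z)) = P ** Z"
    "?Q ** (transpose A ** Z) = A ** (P ** Z)" "transpose A ** (?Q ** Y) = P ** (A ** Y)"
    "A ** (P ** (?Q ** Y)) = ?Q ** Y" "?Q ** (P ** (A ** Y)) = ?Q ** Y"
    for Y :: "real ^ 'k ^ 'n" and Z :: "real ^ 'k ^ 'm"
    by (simp_all add: matrix_mul_assoc r)
  \<comment> \<open>With \<open>+\<close> for the real inverse, \<open>P ** ?Q\<close> is \<open>(A\<^sup>T A)\<^sup>+\<close> and \<open>?Q ** P\<close> is \<open>(A A\<^sup>T)\<^sup>+\<close>, so
    \<open>X0 = (A\<^sup>T A)\<^sup>+ A0\<^sup>T (I - A P) + (I - P A) A0\<^sup>T (A A\<^sup>T)\<^sup>+ - P A0 P\<close>.\<close>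
  define X0 where "X0 = P ** ?Q ** ?T - P ** ?Q ** ?T ** A ** P
    + (?T ** ?Q ** P - P ** A ** ?T ** ?Q ** P) - P ** A0 ** P"
  note simps = X0_def dual_mat_mult dual_mat_transpose dual_mat_eq_iff
    matrix_add_ldistrib matrix_add_rdistrib matrix_diff_ldistrib matrix_diff_rdistrib
    transpose_add transpose_diff matrix_transpose_mul
    r[folded matrix_mul_assoc] r' matrix_mul_assoc[symmetric]
  have "dual_mat A A0 ** dual_mat P X0 ** dual_mat A A0 = dual_mat A A0"
    using A0 by (simp add: simps algebra_simps)
  moreover have "dual_mat P X0 ** dual_mat A A0 ** dual_mat P X0 = dual_mat P X0"
    by (simp add: simps)
  moreover have "transpose (dual_mat A A0 ** dual_mat P X0) = dual_mat A A0 ** dual_mat P X0"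
    by (simp add: simps)
  moreover have "transpose (dual_mat P X0 ** dual_mat A A0) = dual_mat P X0 ** dual_mat A A0"
    by (simp add: simps)
  ultimately have "is_DMPGI (dual_mat A A0) (dual_mat P X0)"
    by (simp add: is_DMPGI_def)
  then show "has_DMPGI (dual_mat A A0)" by (auto simp: has_DMPGI_def)
qed

theorem theorem3p2:
  fixes Eh Fh :: "dual_num ^ 'n ^ 'm"
    and E E0 F F0 :: "real ^ 'n ^ 'm"
  assumes "Eh = dual_mat E E0" and "Fh = dual_mat F F0"
    and "has_DMPGI Eh" and "has_DMPGI Fh"
  shows "dual_minus_le Eh Fh \<longleftrightarrow> minus_le (block_mat E0 E E 0) (block_mat F0 F F 0)"
proof -
  have crit: "has_DMPGI (dual_mat A A0) \<longleftrightarrow> rank (block_mat A0 A A 0) = 2 * rank A"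
    for A A0 :: "real ^ 'n ^ 'm"
    by (simp only: has_DMPGI_dual_mat_iff rank_block_mat_dual(2))
  have "rank (block_mat E0 E E 0) = 2 * rank E" "rank (block_mat F0 F F 0) = 2 * rank F"
    using assms by (simp_all add: crit)
  \<comment> \<open>Together with the next bound this gives
    \<open>2 * (rank F - rank E) \<le> 2 * rank (F - E)\<close>, which is at most the rank of the
    difference block. The ends agree exactly when both bounds are equalities; the second equality is
    \<open>crit\<close> for the difference.\<close>
  moreover have "rank F \<le> rank (F - E) + rank E"
    using rank_add_le[of "F - E" E] by simp
  moreover have "2 * rank (F - E) \<le> rank (block_mat (F0 - E0) (F - E) (F - E) 0)"
    by (rule rank_block_mat_dual(1))
  ultimately show ?thesis
    using assms(1,2)
    by (auto simp: dual_minus_le_def minus_le_def dual_mat_diff block_mat_diff crit)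
qed

end
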